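(* Let $m\ge0$ be an integer. Consider the $m$-skinny slicings, growing from the single cell. The children of a slicing $P$ are obtained by adding either a new horizontal block as a new topmost row, right-aligned with the bounding rectangle, or a new vertical block as a new rightmost column, top-aligned with the bounding rectangle, in all ways such that the result is an $m$-skinny slicing. Label each $m$-skinny slicing by $(h,k)$, where $h$ is the maximal width of an addable horizontal block and $k$ is the height of the rightmost column. Then the root is labelled $(1,1)$, and the labels of the children of a slicing with label $(h,k)$ are given by the following rule $(\Omega_m)$: - $(1,k+1),(2,k+1),\ldots,(h,k+1)$; - together with $(h+1,1),\ldots,(h+1,k-1),(h+1,k)$ if $h<m$; - together with $(m+1,1),\ldots,(m+1,k-1),(h+1,k)$ if $h\ge m$.
   Context: Parallelogram polyominoes are edge-connected sets of unit cells bounded by two lattice paths with steps $(0,1)$ and $(1,0)$ meeting only at their endpoints. The size is $k+\ell-1$ for a $k\times\ell$ bounding rectangle. A Baxter slicing of size $n$ is such a polyomino $P$ of size $n$ divided into $n$ blocks, defined recursively: - for $n=1$, the single cell is the single block; - for $n\ge2$, one block is the topmost row (horizontal block) or the rightmost column (vertical block), and the other blocks form a Baxter slicing of the polyomino obtained by deleting it. For a horizontal block $u$: - $\ell(u)$ is its width; - $X(u)$ is the lowest point of the lower border of $P$ with the abscissa of the right edge of $u$; - $r(u)$ is the number of horizontal steps of the lower border read leftwards from $X(u)$ before a vertical step or the bottom-left corner of $P$ is met. An $m$-skinny slicing is a Baxter slicing in which every horizontal block $u$ satisfies $\ell(u)\le r(u)+m$. *)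

theory Defs
  imports Main "HOL-Library.Multiset"
begin

text \<open>The pair \<open>(i, j)\<close> stands for the unit cell with corners \<open>(i, j)\<close> and
  \<open>(i + 1, j + 1)\<close>. Polyominoes are taken up to translation, and the representative used
  throughout has the bottom-left corner of its bounding rectangle at the origin.\<close>

type_synonym cell = "nat \<times> nat"

datatype step = East | North

fun path_end :: "step list \<Rightarrow> nat \<times> nat" where
  "path_end [] = (0, 0)"
| "path_end (East # p) = (let (x, y) = path_end p in (Suc x, y))"
| "path_end (North # p) = (let (x, y) = path_end p in (x, Suc y))"

definition vertices :: "step list \<Rightarrow> (nat \<times> nat) set" where
  "vertices p = {path_end (take n p) | n. n \<le> length p}"

text \<open>Left endpoints of the horizontal steps of a path.\<close>

definition east_steps :: "step list \<Rightarrow> (nat \<times> nat) set" where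
  "east_steps p = {path_end (take n p) | n. n < length p \<and> p ! n = East}"

definition cells_between :: "step list \<Rightarrow> step list \<Rightarrow> cell set" where
  "cells_between lo up =
    {(i, j). \<exists>y y'. (i, y) \<in> east_steps lo \<and> (i, y') \<in> east_steps up \<and> y \<le> j \<and> j < y'}"

text \<open>Two paths that have the same number of steps so far lie on a common antidiagonal, so paths
  cannot cross without sharing a vertex. The first steps say which path is the lower one.\<close>

definition bounded_by :: "step list \<Rightarrow> step list \<Rightarrow> cell set \<Rightarrow> bool" where
  "bounded_by lo up P \<longleftrightarrow>
    lo \<noteq> [] \<and> up \<noteq> [] \<and> hd lo = East \<and> hd up = North \<and>
    path_end lo = path_end up \<and>
    vertices lo \<inter> vertices up = {(0, 0), path_end lo} \<and>
    P = cells_between lo up"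

definition edge_adjacent :: "cell \<Rightarrow> cell \<Rightarrow> bool" where
  "edge_adjacent c d \<longleftrightarrow>
    (fst c = fst d \<and> (snd d = Suc (snd c) \<or> snd c = Suc (snd d))) \<or>
    (snd c = snd d \<and> (fst d = Suc (fst c) \<or> fst c = Suc (fst d)))"

definition edge_connected :: "cell set \<Rightarrow> bool" where
  "edge_connected P \<longleftrightarrow>
    (\<forall>c\<in>P. \<forall>d\<in>P. (c, d) \<in> {(a, b). a \<in> P \<and> b \<in> P \<and> edge_adjacent a b}\<^sup>*)"

definition parallelogram_polyomino :: "cell set \<Rightarrow> bool" where
  "parallelogram_polyomino P \<longleftrightarrow> edge_connected P \<and> (\<exists>lo up. bounded_by lo up P)"

definition lower_border :: "cell set \<Rightarrow> step list" where
  "lower_border P = (THE lo. \<exists>up. bounded_by lo up P)"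

text \<open>Dimensions of the bounding rectangle of a finite nonempty set of cells.\<close>

definition width :: "cell set \<Rightarrow> nat" where
  "width A = Suc (Max (fst ` A)) - Min (fst ` A)"

definition height :: "cell set \<Rightarrow> nat" where
  "height A = Suc (Max (snd ` A)) - Min (snd ` A)"

definition poly_size :: "cell set \<Rightarrow> nat" where
  "poly_size P = width P + height P - 1"

definition top_row :: "cell set \<Rightarrow> cell set" where
  "top_row P = {c \<in> P. snd c = Max (snd ` P)}"

definition right_column :: "cell set \<Rightarrow> cell set" where
  "right_column P = {c \<in> P. fst c = Max (fst ` P)}"

text \<open>The block of a one-cell polyomino is neither a deleted row nor a deleted column, hence
  the kind \<open>Initial\<close>. A block with more than one cell shows its kind; the kind is recorded
  because a one-cell block does not.\<close>

datatype kind = Initial | Horizontal | Vertical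

type_synonym block = "kind \<times> cell set"

type_synonym slicing = "cell set \<times> block set"

definition single_cell :: slicing where
  "single_cell = ({(0, 0)}, {(Initial, {(0, 0)})})"

text \<open>The size condition matters: deleting the top row lowers the size by more than one when
  that row contains the whole rightmost column, and then the remaining blocks would not be as many
  as the size of what is left.\<close>

inductive baxter_slicing :: "nat \<Rightarrow> slicing \<Rightarrow> bool" where
  single: "baxter_slicing 1 single_cell"
| horizontal: "parallelogram_polyomino P \<Longrightarrow> poly_size P = Suc n \<Longrightarrow>
    baxter_slicing n (P - top_row P, B) \<Longrightarrow>
    baxter_slicing (Suc n) (P, insert (Horizontal, top_row P) B)"
| vertical: "parallelogram_polyomino P \<Longrightarrow> poly_size P = Suc n \<Longrightarrow>
    baxter_slicing n (P - right_column P, B) \<Longrightarrow>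
    baxter_slicing (Suc n) (P, insert (Vertical, right_column P) B)"

text \<open>The point \<open>X(u)\<close>.\<close>

definition X_point :: "cell set \<Rightarrow> cell set \<Rightarrow> nat \<times> nat" where
  "X_point P u = (let a = Suc (Max (fst ` u))
     in (a, Min {y. (a, y) \<in> vertices (lower_border P)}))"

text \<open>The number \<open>r(u)\<close>. The vertex \<open>(x, y)\<close> of a path is reached after exactly
  \<open>x + y\<close> steps.\<close>

definition r_steps :: "cell set \<Rightarrow> cell set \<Rightarrow> nat" where
  "r_steps P u = (let (x, y) = X_point P u
     in length (takeWhile (\<lambda>s. s = East) (rev (take (x + y) (lower_border P)))))"

definition skinny :: "nat \<Rightarrow> slicing \<Rightarrow> bool" where
  "skinny m S \<longleftrightarrow> (\<exists>n. baxter_slicing n S) \<and>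
    (\<forall>u. (Horizontal, u) \<in> snd S \<longrightarrow> width u \<le> r_steps (fst S) u + m)"

definition new_rows :: "cell set \<Rightarrow> cell set set" where
  "new_rows P = {{a..<width P} \<times> {height P} | a. a < width P}"

definition new_columns :: "cell set \<Rightarrow> cell set set" where
  "new_columns P = {{width P} \<times> {b..<height P} | b. b < height P}"

definition add_block :: "kind \<Rightarrow> cell set \<Rightarrow> slicing \<Rightarrow> slicing" where
  "add_block t u S = (fst S \<union> u, insert (t, u) (snd S))"

definition addable_rows :: "nat \<Rightarrow> slicing \<Rightarrow> cell set set" where
  "addable_rows m S = {u \<in> new_rows (fst S). skinny m (add_block Horizontal u S)}"

definition addable_columns :: "nat \<Rightarrow> slicing \<Rightarrow> cell set set" where
  "addable_columns m S = {u \<in> new_columns (fst S). skinny m (add_block Vertical u S)}"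

definition children :: "nat \<Rightarrow> slicing \<Rightarrow> slicing set" where
  "children m S =
    (\<lambda>u. add_block Horizontal u S) ` addable_rows m S \<union>
    (\<lambda>u. add_block Vertical u S) ` addable_columns m S"

definition label :: "nat \<Rightarrow> slicing \<Rightarrow> nat \<times> nat" where
  "label m S = (Max (width ` addable_rows m S), height (right_column (fst S)))"

definition Omega :: "nat \<Rightarrow> nat \<Rightarrow> nat \<Rightarrow> (nat \<times> nat) multiset" where
  "Omega m h k =
    {# (i, k + 1). i \<in># mset_set {1..h} #} +
    (if h < m then {# (h + 1, j). j \<in># mset_set {1..k} #}
     else {# (m + 1, j). j \<in># mset_set {1..<k} #} + {# (h + 1, k) #})"

end

theory Submission
  imports Defs
begin

text \<open>Describe a parallelogram polyomino of width \<open>W\<close> by the bottoms \<open>f i\<close> and the tops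
  \<open>g i\<close> of its columns. Let \<open>t\<close> be the width of the top row, \<open>s\<close> the number of horizontal steps of
  the lower border just before the rightmost column is climbed, and \<open>k\<close> the height of that column.
  A new row must not be wider than the top row, and the skinny condition bounds its width by
  \<open>s + m\<close>, so \<open>h = min t (s + m)\<close>; a new column can have any height up to \<open>k\<close>. A row of width
  \<open>w\<close> turns \<open>(t, s, k)\<close> into \<open>(w, s, k + 1)\<close>. A column of height \<open>j\<close> turns it into
  \<open>(t + 1, s + 1, k)\<close> if \<open>j = k\<close> and into \<open>(t + 1, 1, j)\<close> if \<open>j < k\<close>, because a lower column
  starts a new run of horizontal steps. Finally \<open>h < m\<close> forces \<open>h = t\<close>, and \<open>h \<ge> m\<close>
  forces \<open>t \<ge> m\<close>.\<close>

section \<open>Lattice paths as staircases\<close>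

text \<open>A path is encoded by the heights \<open>f i\<close> of its horizontal steps; \<open>base f n\<close> is the height at
  which the path arrives at abscissa \<open>n\<close>.\<close>

definition base :: "(nat \<Rightarrow> nat) \<Rightarrow> nat \<Rightarrow> nat" where
  "base f n = (case n of 0 \<Rightarrow> 0 | Suc i \<Rightarrow> f i)"

text \<open>Since \<open>base f 0 = 0\<close>, this is monotonicity of \<open>f\<close> on the first
  \<open>n\<close> indices, phrased so that the subtraction in \<open>stairs\<close> never
  truncates.\<close>

definition staircase :: "(nat \<Rightarrow> nat) \<Rightarrow> nat \<Rightarrow> bool" where
  "staircase f n \<longleftrightarrow> (\<forall>i<n. base f i \<le> f i)"

primrec stairs :: "(nat \<Rightarrow> nat) \<Rightarrow> nat \<Rightarrow> step list" where
  "stairs f 0 = []"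
| "stairs f (Suc n) = stairs f n @ replicate (f n - base f n) North @ [East]"

text \<open>The climb after the last horizontal step is kept apart, so that
  \<open>stairs f a\<close> is the piece of the path that ends at its lowest vertex of abscissa
  \<open>a\<close>.\<close>

definition staircase_path :: "(nat \<Rightarrow> nat) \<Rightarrow> nat \<Rightarrow> nat \<Rightarrow> step list" where
  "staircase_path f n H = stairs f n @ replicate (H - base f n) North"

lemma base_simps [simp]: "base f 0 = 0" "base f (Suc i) = f i"
  by (simp_all add: base_def)

lemma staircase_Suc: "staircase f (Suc n) \<longleftrightarrow> staircase f n \<and> base f n \<le> f n"
  by (auto simp: staircase_def less_Suc_eq)

lemma staircaseD: "staircase f n \<Longrightarrow> Suc i < n \<Longrightarrow> f i \<le> f (Suc i)"
  by (auto simp: staircase_def dest: spec[of _ "Suc i"])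

lemma staircase_mono: "staircase f n \<Longrightarrow> i \<le> j \<Longrightarrow> j < n \<Longrightarrow> f i \<le> f j"
proof (induction j)
  case (Suc j)
  then show ?case
    using staircaseD[of f n j] by (cases "i = Suc j") auto
qed auto

lemma base_cong: "(\<And>i. i < n \<Longrightarrow> f i = f' i) \<Longrightarrow> base f n = base f' n"
  by (cases n) auto

lemma staircase_cong: "(\<And>i. i < n \<Longrightarrow> f i = f' i) \<Longrightarrow> staircase f n = staircase f' n"
proof -
  assume eq: "\<And>i. i < n \<Longrightarrow> f i = f' i"
  have "base f i = base f' i" if "i < n" for i
    by (rule base_cong) (use eq that in auto)
  then show ?thesis using eq by (auto simp: staircase_def)
qed

lemma stairs_cong: "(\<And>i. i < n \<Longrightarrow> f i = f' i) \<Longrightarrow> stairs f n = stairs f' n"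
proof (induction n)
  case (Suc n)
  then show ?case using base_cong[of n f f'] by simp
qed simp

section \<open>Endpoints, vertices and horizontal steps of staircase paths\<close>

lemma path_end_append:
  "path_end (p @ q) = (fst (path_end p) + fst (path_end q), snd (path_end p) + snd (path_end q))"
  by (induction p rule: path_end.induct) (auto simp: Let_def split: prod.splits)

lemma path_end_replicate_North: "path_end (replicate c North) = (0, c)"
  by (induction c) auto

lemma path_end_stairs: "staircase f n \<Longrightarrow> path_end (stairs f n) = (n, base f n)"
  by (induction n) (auto simp: path_end_append path_end_replicate_North staircase_Suc)

lemma length_stairs: "staircase f n \<Longrightarrow> length (stairs f n) = n + base f n"
  by (induction n) (auto simp: staircase_Suc)

lemma path_end_staircase_path:
  "staircase f n \<Longrightarrow> base f n \<le> H \<Longrightarrow> path_end (staircase_path f n H) = (n, H)"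
  by (simp add: staircase_path_def path_end_append path_end_replicate_North path_end_stairs)

lemma vertices_snoc: "vertices (p @ [s]) = insert (path_end (p @ [s])) (vertices p)"
proof -
  have "{n. n \<le> length (p @ [s])} = insert (Suc (length p)) {n. n \<le> length p}"
    by auto
  moreover have "vertices q = (\<lambda>n. path_end (take n q)) ` {n. n \<le> length q}" for q
    by (auto simp: vertices_def)
  ultimately show ?thesis by auto
qed

lemma east_steps_snoc:
  "east_steps (p @ [s]) = (if s = East then insert (path_end p) (east_steps p) else east_steps p)"
proof -
  have steps: "east_steps q = (\<lambda>n. path_end (take n q)) ` {n. n < length q \<and> q ! n = East}" for q
    by (auto simp: east_steps_def)
  have "{n. n < length (p @ [s]) \<and> (p @ [s]) ! n = East} =
      {n. n < length p \<and> p ! n = East} \<union> (if s = East then {length p} else {})"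
    by (auto simp: nth_append less_Suc_eq)
  moreover have "(\<lambda>n. path_end (take n (p @ [s]))) ` {n. n < length p \<and> p ! n = East} =
      (\<lambda>n. path_end (take n p)) ` {n. n < length p \<and> p ! n = East}"
    by (rule image_cong) auto
  ultimately show ?thesis by (simp add: steps image_Un)
qed

lemma append_replicate_Suc: "p @ replicate (Suc c) x = (p @ replicate c x) @ [x]"
  by (simp add: replicate_append_same)

lemma vertices_append_North:
  assumes "path_end p = (x, y)"
  shows "vertices (p @ replicate c North) = vertices p \<union> {x} \<times> {y..y + c}"
proof (induction c)
  case 0
  have "path_end p \<in> vertices p"
    unfolding vertices_def by (auto intro!: exI[of _ "length p"])
  then show ?case using assms by auto
next
  case (Suc c)
  have "path_end ((p @ replicate c North) @ [North]) = (x, y + Suc c)"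
    using assms by (simp add: path_end_append path_end_replicate_North)
  then show ?case
    unfolding append_replicate_Suc vertices_snoc Suc by (auto simp: le_Suc_eq)
qed

lemma east_steps_append_North: "east_steps (p @ replicate c North) = east_steps p"
proof (induction c)
  case (Suc c)
  then show ?case unfolding append_replicate_Suc east_steps_snoc by simp
qed simp

lemma east_steps_stairs: "staircase f n \<Longrightarrow> east_steps (stairs f n) = {(i, f i) | i. i < n}"
proof (induction n)
  case 0
  then show ?case by (simp add: east_steps_def)
next
  case (Suc n)
  have "path_end (stairs f n @ replicate (f n - base f n) North) = (n, f n)"
    using Suc.prems
    by (simp add: staircase_Suc path_end_append path_end_replicate_North path_end_stairs)
  then show ?case
    using Suc
    by (auto simp: staircase_Suc less_Suc_eq east_steps_snoc east_steps_append_North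
        simp flip: append_assoc)
qed

lemma vertices_stairs:
  "staircase f n \<Longrightarrow>
    vertices (stairs f n) = {(x, y). x < n \<and> base f x \<le> y \<and> y \<le> f x} \<union> {(n, base f n)}"
proof (induction n)
  case 0
  then show ?case by (auto simp: vertices_def)
next
  case (Suc n)
  let ?q = "stairs f n @ replicate (f n - base f n) North"
  have "path_end (?q @ [East]) = (Suc n, f n)"
    using Suc.prems
    by (simp add: staircase_Suc path_end_append path_end_replicate_North path_end_stairs)
  moreover have "vertices ?q = vertices (stairs f n) \<union> {n} \<times> {base f n..f n}"
    using vertices_append_North[OF path_end_stairs, of f n "f n - base f n"] Suc.prems
    by (simp add: staircase_Suc)
  moreover have "vertices (stairs f (Suc n)) = insert (path_end (?q @ [East])) (vertices ?q)"
    using vertices_snoc[of ?q East] by simp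
  ultimately show ?case
    using Suc by (auto simp: staircase_Suc less_Suc_eq)
qed

lemma vertices_staircase_path:
  "staircase f n \<Longrightarrow> base f n \<le> H \<Longrightarrow>
    vertices (staircase_path f n H) =
      {(x, y). x < n \<and> base f x \<le> y \<and> y \<le> f x} \<union> {n} \<times> {base f n..H}"
  using vertices_append_North[OF path_end_stairs, of f n "H - base f n"]
  by (auto simp: staircase_path_def vertices_stairs)

lemma east_steps_staircase_path:
  "staircase f n \<Longrightarrow> east_steps (staircase_path f n H) = {(i, f i) | i. i < n}"
  by (simp add: staircase_path_def east_steps_append_North east_steps_stairs)

text \<open>Induction from the end of the path: a North step raises \<open>H\<close>, an East step
  fixes \<open>H\<close> as the height of a further horizontal step.\<close>

lemma ex_staircase_path:
  "\<exists>f n H. staircase f n \<and> base f n \<le> H \<and> p = staircase_path f n H"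
proof (induction p rule: rev_induct)
  case Nil
  show ?case
    by (rule exI[of _ "\<lambda>_. 0"], rule exI[of _ 0], rule exI[of _ 0])
      (simp add: staircase_def staircase_path_def)
next
  case (snoc s p)
  then obtain f n H where p: "staircase f n" "base f n \<le> H" "p = staircase_path f n H"
    by blast
  show ?case
  proof (cases s)
    case North
    have "p @ [s] = staircase_path f n (Suc H)"
      using p North by (simp add: staircase_path_def Suc_diff_le replicate_append_same)
    then show ?thesis using p le_SucI by blast
  next
    case East
    let ?f = "f(n := H)"
    \<comment> \<open>All three depend only on the values of \<open>f\<close> below
      \<open>n\<close>.\<close>
    have eq: "base ?f n = base f n" "stairs ?f n = stairs f n" "staircase ?f n = staircase f n"
      by (rule base_cong stairs_cong staircase_cong; simp)+
    have "p @ [s] = staircase_path ?f (Suc n) H"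
      using p East eq by (simp add: staircase_path_def)
    moreover have "staircase ?f (Suc n)" "base ?f (Suc n) \<le> H"
      using p eq by (simp_all add: staircase_Suc)
    ultimately show ?thesis by blast
  qed
qed

section \<open>Initial pieces and final runs of horizontal steps\<close>

lemma stairs_prefix: "a \<le> n \<Longrightarrow> \<exists>q. stairs f n = stairs f a @ q"
  by (induction n) (auto simp: le_Suc_eq)

lemma hd_staircase_path:
  assumes "staircase_path f n H \<noteq> []"
  shows "hd (staircase_path f n H) = East \<longleftrightarrow> 0 < n \<and> f 0 = 0"
proof -
  \<comment> \<open>The path opens with exactly \<open>f 0\<close> North steps, so its first step is
    East just when \<open>f 0 = 0\<close>.\<close>
  have *: "\<exists>q. stairs f (Suc k) = replicate (f 0) North @ East # q" for k
    using stairs_prefix[of "Suc 0" "Suc k" f] by auto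
  show ?thesis
  proof (cases n)
    case 0
    then show ?thesis using assms by (simp add: staircase_path_def)
  next
    case (Suc k)
    then obtain q where "stairs f n = replicate (f 0) North @ East # q"
      using * by blast
    then show ?thesis using Suc by (cases "f 0") (auto simp: staircase_path_def)
  qed
qed

text \<open>Abscissa \<open>a\<close> is reached after \<open>a\<close> East and
  \<open>base f a\<close> North steps.\<close>

lemma take_staircase_path:
  assumes "staircase f n" "a \<le> n"
  shows "take (a + base f a) (staircase_path f n H) = stairs f a"
proof -
  have "staircase f a" using assms by (auto simp: staircase_def)
  moreover obtain q where "stairs f n = stairs f a @ q"
    using stairs_prefix assms(2) by blast
  ultimately show ?thesis by (simp add: staircase_path_def length_stairs)
qed

text \<open>This is r(u) for a block u whose right edge has abscissa \<open>a\<close>, see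
  \<open>r_steps_eq\<close>.\<close>

definition last_run :: "(nat \<Rightarrow> nat) \<Rightarrow> nat \<Rightarrow> nat" where
  "last_run f a = length (takeWhile (\<lambda>s. s = East) (rev (stairs f a)))"

text \<open>A climb just before the last East step ends the earlier run; without one that run is
  prolonged.\<close>

lemma last_run_Suc:
  assumes "staircase f (Suc n)"
  shows "last_run f (Suc n) = Suc (if f n = base f n then last_run f n else 0)"
proof (cases "f n - base f n")
  case 0
  then show ?thesis using assms by (simp add: last_run_def staircase_Suc)
next
  case (Suc c)
  then show ?thesis by (auto simp: last_run_def replicate_app_Cons_same)
qed

section \<open>Parallelogram polyominoes by columns\<close>

text \<open>The strict inequality \<open>f (Suc i) < g i\<close> says that neighbouring columns
  share an edge, and also that the two borders do not meet at abscissa \<open>Suc i\<close>.\<close>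

definition column_shape :: "nat \<Rightarrow> (nat \<Rightarrow> nat) \<Rightarrow> (nat \<Rightarrow> nat) \<Rightarrow> cell set \<Rightarrow> bool" where
  "column_shape W f g P \<longleftrightarrow>
    0 < W \<and> f 0 = 0 \<and> 0 < g 0 \<and> staircase f W \<and> staircase g W \<and>
    (\<forall>i. Suc i < W \<longrightarrow> f (Suc i) < g i) \<and>
    P = {(i, j). i < W \<and> f i \<le> j \<and> j < g i}"

text \<open>Neighbouring columns overlap and tops do not decrease:
  \<open>f (Suc k) < g k \<le> g (Suc k)\<close>.\<close>

lemma column_shape_less:
  assumes "column_shape W f g P" "i < W"
  shows "f i < g i"
proof (cases i)
  case (Suc k)
  then show ?thesis
    using assms staircaseD[of g W k] by (auto simp: column_shape_def intro: less_le_trans)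
qed (use assms in \<open>auto simp: column_shape_def\<close>)

text \<open>Over an interior abscissa \<open>Suc i\<close> the borders occupy the height intervals
  from \<open>f i\<close> to \<open>f (Suc i)\<close> and from \<open>g i\<close> to
  \<open>g (Suc i)\<close>. These are disjoint and the lower path starts below, so the order
  persists column by column.\<close>

lemma bounded_by_imp_column_shape:
  assumes "bounded_by lo up P"
  shows "\<exists>W f g. column_shape W f g P \<and> lo = staircase_path f W (g (W - 1))"
proof -
  obtain f n H where lo: "staircase f n" "base f n \<le> H" "lo = staircase_path f n H"
    using ex_staircase_path by blast
  obtain g n' H' where up: "staircase g n'" "base g n' \<le> H'" "up = staircase_path g n' H'"
    using ex_staircase_path by blast
  note b = assms[unfolded bounded_by_def]
  have n: "n' = n" "H' = H"
    using b lo up by (auto simp: path_end_staircase_path)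
  note up = up[unfolded n]
  have f0: "0 < n" "f 0 = 0"
    using b hd_staircase_path[of f n H] lo by auto
  have g0: "0 < g 0"
    using b hd_staircase_path[of g n H] up f0 by auto
  have int: "vertices lo \<inter> vertices up = {(0, 0), (n, H)}"
    using b lo by (auto simp: path_end_staircase_path)
  have vlo: "vertices lo = {(x, y). x < n \<and> base f x \<le> y \<and> y \<le> f x} \<union> {n} \<times> {base f n..H}"
    using lo by (simp add: vertices_staircase_path)
  have vup: "vertices up = {(x, y). x < n \<and> base g x \<le> y \<and> y \<le> g x} \<union> {n} \<times> {base g n..H}"
    using up by (simp add: vertices_staircase_path)
  have touch: False
    if "Suc i < n" "f i \<le> y" "y \<le> f (Suc i)" "g i \<le> y" "y \<le> g (Suc i)" for i y
  proof -
    have "(Suc i, y) \<in> vertices lo \<inter> vertices up" using that vlo vup by auto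
    then show False using int that by auto
  qed
  \<comment> \<open>If the lower path climbed to height \<open>g i\<close> at this abscissa, the
    borders would share the vertex there.\<close>
  have step: "f (Suc i) < g i" if "f i < g i" "Suc i < n" for i
    using touch[of i "g i"] staircaseD[of g n i] that up by fastforce
  have less: "i < n \<longrightarrow> f i < g i" for i
  proof (induction i)
    case (Suc i)
    then show ?case using step[of i] staircaseD[of g n i] up by fastforce
  qed (use f0 g0 in auto)
  obtain k where k: "n = Suc k" using f0 by (cases n) auto
  \<comment> \<open>The upper path reaches the last abscissa at height \<open>g k\<close>, a point
    on the final climb of the lower path. Only the endpoint is shared there, so the upper path has
    no final climb.\<close>
  have "(n, g k) \<in> vertices lo \<inter> vertices up"
    using vlo vup less[of k] up k by auto
  then have gk: "g k = H" using int f0 by auto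
  have "P = {(i, j). i < n \<and> f i \<le> j \<and> j < g i}"
    using b lo up by (auto simp: cells_between_def east_steps_staircase_path)
  then have "column_shape n f g P"
    using f0 g0 lo up step less by (auto simp: column_shape_def)
  then show ?thesis using lo gk k by (intro exI[of _ n] exI[of _ f] exI[of _ g]) auto
qed

lemma column_shape_imp_bounded_by:
  assumes "column_shape W f g P"
  shows "bounded_by (staircase_path f W (g (W - 1))) (staircase_path g W (g (W - 1))) P"
proof -
  note s = assms[unfolded column_shape_def]
  obtain k where k: "W = Suc k" using s by (cases W) auto
  let ?H = "g (W - 1)"
  have H: "base f W \<le> ?H" "base g W \<le> ?H" "f k < ?H"
    using column_shape_less[OF assms, of k] k by auto
  have e: "path_end (staircase_path f W ?H) = (W, ?H)" "path_end (staircase_path g W ?H) = (W, ?H)"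
    using s H by (auto simp: path_end_staircase_path)
  have ne: "staircase_path f W ?H \<noteq> []" "staircase_path g W ?H \<noteq> []"
    using e k by auto
  have hdl: "hd (staircase_path f W ?H) = East"
    using hd_staircase_path[OF ne(1)] s by auto
  have "hd (staircase_path g W ?H) \<noteq> East"
    using hd_staircase_path[OF ne(2)] s by auto
  then have hdu: "hd (staircase_path g W ?H) = North"
    by (cases "hd (staircase_path g W ?H)") auto
  \<comment> \<open>At abscissa 0 the lower path has only the origin, at \<open>W\<close> the upper
    path has only the endpoint, and in between \<open>f (Suc i) < g i\<close> keeps the height
    intervals apart.\<close>
  have "(x, y) \<in> vertices (staircase_path f W ?H) \<inter> vertices (staircase_path g W ?H)
    \<longleftrightarrow> (x, y) \<in> {(0, 0), (W, ?H)}" for x y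
  proof (cases x)
    case 0
    then show ?thesis using s H k by (auto simp: vertices_staircase_path)
  next
    case (Suc i)
    have "\<not> (g i \<le> y \<and> y \<le> f (Suc i))" if "Suc i < W" using s that by fastforce
    then show ?thesis using s H k Suc by (auto simp: vertices_staircase_path)
  qed
  then have int: "vertices (staircase_path f W ?H) \<inter> vertices (staircase_path g W ?H)
    = {(0, 0), (W, ?H)}"
    by (intro set_eqI) (metis surj_pair)
  have "P = cells_between (staircase_path f W ?H) (staircase_path g W ?H)"
    using s by (auto simp: cells_between_def east_steps_staircase_path)
  then show ?thesis
    unfolding bounded_by_def using e ne hdl hdu int by auto
qed

text \<open>Every cell is joined to the origin: descend in its column to the bottom, step left at
  the same height, which \<open>f i \<le> f (Suc i) < g i\<close> permits, and repeat. Adjacency is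
  symmetric, so any two cells are joined through the origin.\<close>

lemma column_shape_edge_connected:
  assumes "column_shape W f g P"
  shows "edge_connected P"
proof -
  note s = assms[unfolded column_shape_def]
  define R where "R = {(a, b). a \<in> P \<and> b \<in> P \<and> edge_adjacent a b}"
  have mem: "(i, j) \<in> P \<longleftrightarrow> i < W \<and> f i \<le> j \<and> j < g i" for i j using s by auto
  have "sym R" by (auto simp: R_def sym_def edge_adjacent_def)
  then have symR: "sym (R\<^sup>*)" by (rule sym_rtrancl)
  have col: "((i, j), (i, f i)) \<in> R\<^sup>*" if "(i, j) \<in> P" for i j
    using that
  proof (induction j)
    case (Suc j)
    show ?case
    proof (cases "f i = Suc j")
      case False
      then have "(i, j) \<in> P" using Suc.prems by (auto simp: mem)
      moreover from this have "((i, Suc j), (i, j)) \<in> R"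
        using Suc.prems by (auto simp: R_def edge_adjacent_def)
      ultimately show ?thesis using Suc.IH by (meson converse_rtrancl_into_rtrancl)
    qed simp
  qed (auto simp: mem)
  have bottom: "i < W \<longrightarrow> ((i, f i), (0, 0)) \<in> R\<^sup>*" for i
  proof (induction i)
    case (Suc i)
    show ?case
    proof
      assume i: "Suc i < W"
      have "(i, f (Suc i)) \<in> P" "(Suc i, f (Suc i)) \<in> P"
        using s i staircaseD[of f W i] column_shape_less[OF assms, of "Suc i"] by (auto simp: mem)
      moreover from this have "((Suc i, f (Suc i)), (i, f (Suc i))) \<in> R"
        by (auto simp: R_def edge_adjacent_def)
      ultimately show "((Suc i, f (Suc i)), (0, 0)) \<in> R\<^sup>*"
        using col[of i "f (Suc i)"] Suc.IH i
        by (meson Suc_lessD converse_rtrancl_into_rtrancl rtrancl_trans)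
    qed
  qed (use s in auto)
  have "(c, (0, 0)) \<in> R\<^sup>*" if "c \<in> P" for c
    using col[of "fst c" "snd c"] bottom[of "fst c"] that mem[of "fst c" "snd c"]
    by (auto intro: rtrancl_trans)
  then have "(c, d) \<in> R\<^sup>*" if "c \<in> P" "d \<in> P" for c d
    using that symR by (meson rtrancl_trans symD)
  then show ?thesis unfolding edge_connected_def R_def by blast
qed

lemma parallelogram_polyomino_iff:
  "parallelogram_polyomino P \<longleftrightarrow> (\<exists>W f g. column_shape W f g P)"
  unfolding parallelogram_polyomino_def
  using bounded_by_imp_column_shape column_shape_imp_bounded_by column_shape_edge_connected
  by blast

section \<open>Bounding rectangle, top row and rightmost column\<close>

lemma column_shape_mem: "column_shape W f g P \<Longrightarrow> (i, j) \<in> P \<longleftrightarrow> i < W \<and> f i \<le> j \<and> j < g i"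
  by (auto simp: column_shape_def)

lemma column_shape_le_top: "column_shape W f g P \<Longrightarrow> i < W \<Longrightarrow> g i \<le> g (W - 1)"
  by (rule staircase_mono[of g W]) (auto simp: column_shape_def)

lemma column_shape_fst_image:
  assumes "column_shape W f g P"
  shows "fst ` P = {..<W}"
proof -
  have "i \<in> fst ` P" if "i < W" for i
    using column_shape_less[OF assms that] column_shape_mem[OF assms, of i "f i"] that
    by force
  then show ?thesis using column_shape_mem[OF assms] by auto
qed

text \<open>No height is skipped: those from \<open>g k\<close> up to \<open>g (Suc k)\<close> lie
  in column \<open>Suc k\<close>, whose bottom is below \<open>g k\<close>.\<close>

lemma column_shape_snd_image:
  assumes "column_shape W f g P"
  shows "snd ` P = {..<g (W - 1)}"
proof -
  note s = assms[unfolded column_shape_def]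
  have "\<forall>j<g k. k < W \<longrightarrow> (\<exists>i. (i, j) \<in> P)" for k
  proof (induction k)
    case 0
    then show ?case using s by auto
  next
    case (Suc k)
    show ?case
    proof (intro allI impI)
      fix j assume j: "j < g (Suc k)" "Suc k < W"
      show "\<exists>i. (i, j) \<in> P"
      proof (cases "j < g k")
        case False
        then have "f (Suc k) \<le> j" using s j by fastforce
        then show ?thesis using j column_shape_mem[OF assms] by blast
      qed (use Suc j in auto)
    qed
  qed
  moreover have "W - 1 < W" using s by auto
  moreover have "j < g (W - 1)" if "(i, j) \<in> P" for i j
    using that column_shape_le_top[OF assms, of i] column_shape_mem[OF assms, of i j] by auto
  ultimately show ?thesis by force
qed

lemma Max_lessThan_nat: "0 < n \<Longrightarrow> Max {..<n::nat} = n - 1"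
  by (rule Max_eqI) auto

lemma Min_lessThan_nat: "0 < n \<Longrightarrow> Min {..<n::nat} = 0"
  by (rule Min_eqI) auto

lemma column_shape_pos:
  assumes "column_shape W f g P"
  shows "0 < W" "0 < g (W - 1)"
  using column_shape_less[OF assms, of "W - 1"] assms by (auto simp: column_shape_def)

lemma column_shape_dimensions:
  assumes "column_shape W f g P"
  shows "width P = W" "height P = g (W - 1)"
  using column_shape_pos[OF assms]
  by (simp_all add: width_def height_def column_shape_fst_image[OF assms]
      column_shape_snd_image[OF assms] Max_lessThan_nat Min_lessThan_nat)

lemma column_shape_poly_size: "column_shape W f g P \<Longrightarrow> poly_size P = W + g (W - 1) - 1"
  by (simp add: poly_size_def column_shape_dimensions)

lemma column_shape_right_column:
  assumes "column_shape W f g P"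
  shows "right_column P = {W - 1} \<times> {f (W - 1)..<g (W - 1)}"
  using column_shape_pos[OF assms] column_shape_mem[OF assms]
  by (auto simp: right_column_def column_shape_fst_image[OF assms] Max_lessThan_nat)

lemma column_shape_top_row:
  assumes "column_shape W f g P"
  shows "top_row P = {c \<in> P. snd c = g (W - 1) - 1}"
  using column_shape_pos[OF assms]
  by (auto simp: top_row_def column_shape_snd_image[OF assms] Max_lessThan_nat)

lemma width_rectangle: "a < b \<Longrightarrow> B \<noteq> {} \<Longrightarrow> width ({a..<b} \<times> B) = b - a"
proof -
  assume ab: "a < b" "B \<noteq> {}"
  have "Max {a..<b} = b - 1" "Min {a..<b} = a"
    by (rule Max_eqI Min_eqI; use ab in auto)+
  then show ?thesis using ab by (simp add: width_def)
qed

lemma height_rectangle: "a < b \<Longrightarrow> A \<noteq> {} \<Longrightarrow> height (A \<times> {a..<b}) = b - a"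
proof -
  assume ab: "a < b" "A \<noteq> {}"
  have "Max {a..<b} = b - 1" "Min {a..<b} = a"
    by (rule Max_eqI Min_eqI; use ab in auto)+
  then show ?thesis using ab by (simp add: height_def)
qed

section \<open>Uniqueness of the columns, the lower border and r(u)\<close>

lemma column_shape_unique:
  assumes "column_shape W f g P" "column_shape W' f' g' P"
  shows "W' = W" "i < W \<Longrightarrow> f' i = f i" "i < W \<Longrightarrow> g' i = g i"
proof -
  show W: "W' = W" using column_shape_dimensions assms by metis
  assume i: "i < W"
  have "f i \<le> j \<and> j < g i \<longleftrightarrow> f' i \<le> j \<and> j < g' i" for j
    using column_shape_mem[OF assms(1), of i j] column_shape_mem[OF assms(2), of i j] i W by auto
  \<comment> \<open>Both intervals are nonempty, so they determine their ends.\<close>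
  then have "{f i..<g i} = {f' i..<g' i}" by (intro set_eqI) (simp only: atLeastLessThan_iff)
  then show "f' i = f i" "g' i = g i"
    using column_shape_less[OF assms(1) i] column_shape_less[OF assms(2), of i] i W
    by (metis atLeastLessThan_eq_iff)+
qed

text \<open>Two column descriptions of \<open>P\<close> agree on the indices below \<open>W\<close>,
  and the path depends on no others.\<close>

lemma lower_border_eq:
  assumes "column_shape W f g P"
  shows "lower_border P = staircase_path f W (g (W - 1))"
  unfolding lower_border_def
proof (rule the_equality)
  show "\<exists>up. bounded_by (staircase_path f W (g (W - 1))) up P"
    using column_shape_imp_bounded_by[OF assms] by blast
next
  fix lo assume "\<exists>up. bounded_by lo up P"
  then obtain W' f' g' where *: "column_shape W' f' g' P"
    and lo: "lo = staircase_path f' W' (g' (W' - 1))"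
    using bounded_by_imp_column_shape by blast
  note u = column_shape_unique[OF assms *]
  have "stairs f' W = stairs f W" "base f' W = base f W"
    using u by (auto intro: stairs_cong base_cong)
  moreover have "g' (W - 1) = g (W - 1)"
    using u column_shape_pos[OF assms] by auto
  ultimately show "lo = staircase_path f W (g (W - 1))"
    using lo u(1) by (simp add: staircase_path_def)
qed

text \<open>With \<open>i\<close> the last column of \<open>u\<close>, the point X(u) is
  \<open>(Suc i, f i)\<close>, the end of the horizontal step under that column. The border up to
  there is \<open>stairs f (Suc i)\<close>.\<close>

lemma r_steps_eq:
  assumes P: "column_shape W f g P" and u: "Max (fst ` u) < W"
  shows "r_steps P u = last_run f (Suc (Max (fst ` u)))"
proof -
  have s: "0 < W" "staircase f W" using P by (auto simp: column_shape_def)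
  let ?i = "Max (fst ` u)" and ?H = "g (W - 1)"
  have fg: "f ?i < g ?i" "g ?i \<le> ?H"
    using column_shape_less[OF P u] column_shape_le_top[OF P u] by auto
  have fW: "base f W \<le> ?H"
    using column_shape_less[OF P, of "W - 1"] s by (cases W) auto
  \<comment> \<open>From that point the border climbs to its next horizontal step or, at the right
    edge, to the top corner.\<close>
  have v: "{y. (Suc ?i, y) \<in> vertices (lower_border P)} =
      {f ?i..(if Suc ?i < W then f (Suc ?i) else ?H)}"
    unfolding lower_border_eq[OF P] vertices_staircase_path[OF s(2) fW]
    using u by (cases "Suc ?i < W") (auto simp: not_less le_Suc_eq)
  have "f ?i \<le> (if Suc ?i < W then f (Suc ?i) else ?H)"
    using fg s staircaseD[of f W ?i] by auto
  then have "X_point P u = (Suc ?i, f ?i)"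
    unfolding X_point_def Let_def v by (auto intro: Min_eqI)
  moreover have "take (Suc ?i + f ?i) (lower_border P) = stairs f (Suc ?i)"
    using take_staircase_path[of f W "Suc ?i" ?H] s u by (simp add: lower_border_eq[OF P])
  ultimately show ?thesis
    by (simp add: r_steps_def last_run_def)
qed

section \<open>Adding a row or a column\<close>

text \<open>By monotonicity, all columns from \<open>a\<close> on reach the top if column
  \<open>a\<close> does, so the new row rests on cells along its whole length.\<close>

lemma column_shape_add_row:
  assumes P: "column_shape W f g P" and a: "a < W" "g a = g (W - 1)"
  shows "column_shape W f (\<lambda>i. if a \<le> i then Suc (g (W - 1)) else g i)
    (P \<union> {a..<W} \<times> {g (W - 1)})" (is "column_shape W f ?g ?P")
proof -
  note s = P[unfolded column_shape_def]
  have top: "g i = g (W - 1)" if "a \<le> i" "i < W" for i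
    using staircase_mono[of g W a i] column_shape_le_top[OF P, of i] s a that by auto
  have le: "f i < g i \<and> g i \<le> g (W - 1)" if "i < W" for i
    using column_shape_less[OF P that] column_shape_le_top[OF P that] by auto
  have "staircase ?g W"
    unfolding staircase_def
  proof (intro allI impI)
    fix i assume i: "i < W"
    show "base ?g i \<le> ?g i"
      using s i le[of "i - 1"] staircaseD[of g W "i - 1"] by (cases i) auto
  qed
  moreover have "f (Suc i) < ?g i" if "Suc i < W" for i
    using s that le[of "Suc i"] by auto
  moreover have "(i, j) \<in> ?P \<longleftrightarrow> i < W \<and> f i \<le> j \<and> j < ?g i" for i j
  proof (cases "i < W \<and> a \<le> i")
    case True
    then show ?thesis
      using column_shape_mem[OF P, of i j] top[of i] le[of i] by (auto simp: less_Suc_eq)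
  next
    case False
    then show ?thesis using column_shape_mem[OF P, of i j] by auto
  qed
  then have "?P = {(i, j). i < W \<and> f i \<le> j \<and> j < ?g i}"
    by (intro set_eqI) (simp only: split_paired_all mem_Collect_eq prod.case)
  ultimately show ?thesis using s by (auto simp: column_shape_def)
qed

text \<open>The bound \<open>f (W - 1) \<le> b\<close> keeps the lower border monotone, and
  \<open>b < g (W - 1)\<close> makes the new column touch the last one.\<close>

lemma column_shape_add_column:
  assumes P: "column_shape W f g P" and b: "b < g (W - 1)" "f (W - 1) \<le> b"
  shows "column_shape (Suc W) (f(W := b)) (g(W := g (W - 1)))
    (P \<union> {W} \<times> {b..<g (W - 1)})" (is "column_shape _ ?f ?g ?P")
proof -
  note s = P[unfolded column_shape_def]
  obtain k where k: "W = Suc k" using s by (cases W) auto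
  have "staircase ?f W = staircase f W" "staircase ?g W = staircase g W"
    by (auto intro!: staircase_cong)
  then have "staircase ?f (Suc W)" "staircase ?g (Suc W)"
    using s b k by (auto simp: staircase_Suc)
  moreover have "?f (Suc i) < ?g i" if "Suc i < Suc W" for i
    using s that k b by auto
  moreover have "?P = {(i, j). i < Suc W \<and> ?f i \<le> j \<and> j < ?g i}"
    using s by (auto simp: less_Suc_eq)
  ultimately show ?thesis using s k by (auto simp: column_shape_def)
qed

text \<open>Columns are intervals: column \<open>a\<close> contains an old cell and the new one at
  height \<open>?H\<close>, hence also the cell at \<open>?H - 1\<close>, which must be old.\<close>

lemma add_row_parallelogramD:
  assumes P: "column_shape W f g P" and a: "a < W"
    and pp: "parallelogram_polyomino (P \<union> {a..<W} \<times> {g (W - 1)})"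
  shows "g a = g (W - 1)"
proof -
  let ?H = "g (W - 1)"
  obtain W' f' g' where P': "column_shape W' f' g' (P \<union> {a..<W} \<times> {?H})"
    using pp parallelogram_polyomino_iff by blast
  note m = column_shape_mem[OF P, of a] and m' = column_shape_mem[OF P', of a]
  have fg: "f a < g a" "g a \<le> ?H"
    using column_shape_less[OF P a] column_shape_le_top[OF P a] by auto
  have "a < W'" "f' a \<le> f a" "?H < g' a"
    using m'[of "f a"] m'[of ?H] m[of "f a"] a fg by auto
  then have "(a, ?H - 1) \<in> P \<union> {a..<W} \<times> {?H}"
    using m'[of "?H - 1"] fg by auto
  then have "(a, ?H - 1) \<in> P" using fg by auto
  then show ?thesis using m[of "?H - 1"] fg by auto
qed

text \<open>Bottoms of columns do not decrease, and column \<open>k\<close> of the union consists of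
  old cells, so \<open>f k \<le> f' k \<le> f' W \<le> b\<close>.\<close>

lemma add_column_parallelogramD:
  assumes P: "column_shape W f g P" and b: "b < g (W - 1)"
    and pp: "parallelogram_polyomino (P \<union> {W} \<times> {b..<g (W - 1)})"
  shows "f (W - 1) \<le> b"
proof -
  let ?P = "P \<union> {W} \<times> {b..<g (W - 1)}"
  obtain W' f' g' where P': "column_shape W' f' g' ?P"
    using pp parallelogram_polyomino_iff by blast
  note m = column_shape_mem[OF P] and m' = column_shape_mem[OF P']
  obtain k where k: "W = Suc k" using column_shape_pos[OF P] by (cases W) auto
  have W': "W < W'" "f' W \<le> b"
    using m'[of W b] b by auto
  have "(k, f' k) \<in> ?P" using column_shape_less[OF P', of k] W' k m'[of k "f' k"] by auto
  then have "f k \<le> f' k" using m[of k "f' k"] k by auto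
  also have "f' k \<le> f' W"
    using staircaseD[of f' W' k] P' k W' by (auto simp: column_shape_def)
  finally show ?thesis using W' k by auto
qed

text \<open>Tops are monotone, so the columns that reach the maximal height form a final segment.
  Its length \<open>t\<close> is the width of the top row.\<close>

lemma top_width:
  assumes P: "column_shape W f g P"
  shows "\<exists>t. 1 \<le> t \<and> t \<le> W \<and> (\<forall>i<W. g i = g (W - 1) \<longleftrightarrow> W - t \<le> i)"
proof -
  let ?l = "LEAST i. g i = g (W - 1)"
  have l: "g ?l = g (W - 1)" by (rule LeastI) simp
  have lW: "?l \<le> W - 1" by (rule Least_le) simp
  have "g i = g (W - 1) \<longleftrightarrow> ?l \<le> i" if "i < W" for i
  proof
    assume "?l \<le> i"
    then have "g ?l \<le> g i"
      using P that by (auto simp: column_shape_def intro: staircase_mono)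
    then show "g i = g (W - 1)" using l column_shape_le_top[OF P that] by auto
  qed (rule Least_le)
  then show ?thesis
    using lW column_shape_pos[OF P] by (intro exI[of _ "W - ?l"]) auto
qed

section \<open>Baxter slicings\<close>

lemma column_shape_single_cell: "column_shape 1 (\<lambda>_. 0) (\<lambda>_. 1) {(0, 0)}"
  by (auto simp: column_shape_def staircase_def base_def split: nat.splits)

lemma baxter_slicing_polyomino:
  "baxter_slicing n S \<Longrightarrow> parallelogram_polyomino (fst S) \<and> poly_size (fst S) = n"
proof (induction rule: baxter_slicing.induct)
  case single
  show ?case
    using column_shape_single_cell column_shape_poly_size[OF column_shape_single_cell]
    by (auto simp: single_cell_def parallelogram_polyomino_iff)
qed auto

lemma parallelogram_nonempty_finite:
  assumes "parallelogram_polyomino P"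
  shows "P \<noteq> {}" "finite P"
proof -
  obtain W f g where s: "column_shape W f g P"
    using assms parallelogram_polyomino_iff by blast
  show "P \<noteq> {}" using column_shape_fst_image[OF s] column_shape_pos[OF s] by auto
  have "P \<subseteq> fst ` P \<times> snd ` P" by force
  then show "finite P"
    by (rule finite_subset) (simp add: column_shape_fst_image[OF s] column_shape_snd_image[OF s])
qed

lemma top_row_nonempty: "finite P \<Longrightarrow> P \<noteq> {} \<Longrightarrow> top_row P \<noteq> {}"
proof -
  assume "finite P" "P \<noteq> {}"
  then have "Max (snd ` P) \<in> snd ` P" by (intro Max_in) auto
  then obtain c where "c \<in> P" "snd c = Max (snd ` P)" by force
  then have "c \<in> top_row P" by (simp add: top_row_def)
  then show "top_row P \<noteq> {}" by blast
qed

lemma right_column_nonempty: "finite P \<Longrightarrow> P \<noteq> {} \<Longrightarrow> right_column P \<noteq> {}"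
proof -
  assume "finite P" "P \<noteq> {}"
  then have "Max (fst ` P) \<in> fst ` P" by (intro Max_in) auto
  then obtain c where "c \<in> P" "fst c = Max (fst ` P)" by force
  then have "c \<in> right_column P" by (simp add: right_column_def)
  then show "right_column P \<noteq> {}" by blast
qed

text \<open>This guarantees that the right edge of an old block bounds an existing column, where the
  lower border is not altered by additions.\<close>

lemma baxter_slicing_blocks:
  "baxter_slicing n S \<Longrightarrow> \<forall>(t, u) \<in> snd S. u \<noteq> {} \<and> u \<subseteq> fst S"
proof (induction rule: baxter_slicing.induct)
  case single
  show ?case by (auto simp: single_cell_def)
next
  case (horizontal P n B)
  then show ?case
    using top_row_nonempty[of P] parallelogram_nonempty_finite[of P]
    by (auto simp: top_row_def)
next
  case (vertical P n B)
  then show ?case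
    using right_column_nonempty[of P] parallelogram_nonempty_finite[of P]
    by (auto simp: right_column_def)
qed

lemma skinny_column_shape: "skinny m S \<Longrightarrow> \<exists>W f g. column_shape W f g (fst S)"
  unfolding skinny_def using baxter_slicing_polyomino parallelogram_polyomino_iff by blast

text \<open>Additions on the right or on top leave unchanged the part of the lower border before any
  point \<open>X(u)\<close>, so only the new block has to be tested.\<close>

lemma r_steps_extend:
  assumes P: "column_shape W f g P" and P': "column_shape W' f' g' P'"
    and eq: "W \<le> W'" "\<And>i. i < W \<Longrightarrow> f' i = f i" and u: "u \<noteq> {}" "u \<subseteq> P"
  shows "r_steps P' u = r_steps P u"
proof -
  have "fst ` u \<subseteq> {..<W}" using column_shape_fst_image[OF P] u by blast
  then have "finite (fst ` u)" by (rule finite_subset) simp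
  then have "Max (fst ` u) \<in> fst ` u" using u by (intro Max_in) auto
  then have lt: "Max (fst ` u) < W" using column_shape_fst_image[OF P] u by auto
  have "stairs f' (Suc (Max (fst ` u))) = stairs f (Suc (Max (fst ` u)))"
    by (rule stairs_cong) (use eq lt in auto)
  moreover have "Max (fst ` u) < W'" using lt eq by simp
  ultimately show ?thesis
    using r_steps_eq[OF P lt] r_steps_eq[OF P'] by (simp only: last_run_def)
qed

lemma skinny_extend:
  assumes S: "skinny m S" and P: "column_shape W f g (fst S)"
    and P': "column_shape W' f' g' (fst S \<union> u)"
    and eq: "W \<le> W'" "\<And>i. i < W \<Longrightarrow> f' i = f i"
    and b: "\<And>n. baxter_slicing n S \<Longrightarrow> baxter_slicing (Suc n) (add_block t u S)"
  shows "skinny m (add_block t u S) \<longleftrightarrow>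
    (t = Horizontal \<longrightarrow> width u \<le> r_steps (fst S \<union> u) u + m)"
proof -
  obtain n where n: "baxter_slicing n S" using S by (auto simp: skinny_def)
  have "r_steps (fst S \<union> u) v = r_steps (fst S) v" if "(t', v) \<in> snd S" for t' v
  proof -
    have "v \<noteq> {}" "v \<subseteq> fst S" using baxter_slicing_blocks[OF n] that by auto
    then show ?thesis by (intro r_steps_extend[OF P P'] eq)
  qed
  then show ?thesis
    using S b[OF n] by (auto simp: skinny_def add_block_def)
qed

text \<open>All of \<open>fst S\<close> lies below height \<open>g (W - 1)\<close>, so the added
  cells are exactly the top row of the union, and the size grows by one through the height.\<close>

lemma baxter_slicing_add_row:
  assumes b: "baxter_slicing n S" and P: "column_shape W f g (fst S)"
    and a: "a < W" "g a = g (W - 1)"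
  shows "baxter_slicing (Suc n) (add_block Horizontal ({a..<W} \<times> {g (W - 1)}) S)"
proof -
  let ?H = "g (W - 1)"
  let ?u = "{a..<W} \<times> {?H}"
  note P' = column_shape_add_row[OF P a]
  have "n = W + ?H - 1"
    using baxter_slicing_polyomino[OF b] column_shape_poly_size[OF P] by simp
  then have size: "poly_size (fst S \<union> ?u) = Suc n"
    using column_shape_poly_size[OF P'] column_shape_pos[OF P] a by auto
  have notin: "j < ?H" if "(i, j) \<in> fst S" for i j
    using column_shape_snd_image[OF P] that by (metis imageI lessThan_iff snd_conv)
  then have row: "top_row (fst S \<union> ?u) = ?u"
    using column_shape_top_row[OF P'] a by (auto dest: notin)
  have "fst S \<union> ?u - ?u = fst S" by (auto dest: notin)
  then have "baxter_slicing n (fst S \<union> ?u - top_row (fst S \<union> ?u), snd S)"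
    using b row by simp
  then have "baxter_slicing (Suc n)
      (fst S \<union> ?u, insert (Horizontal, top_row (fst S \<union> ?u)) (snd S))"
    using P' size by (intro baxter_slicing.horizontal) (auto simp: parallelogram_polyomino_iff)
  then show ?thesis unfolding add_block_def row .
qed

text \<open>The added cells are the rightmost column of the union, and the size grows by one through
  the width.\<close>

lemma baxter_slicing_add_column:
  assumes b: "baxter_slicing n S" and P: "column_shape W f g (fst S)"
    and h: "b < g (W - 1)" "f (W - 1) \<le> b"
  shows "baxter_slicing (Suc n) (add_block Vertical ({W} \<times> {b..<g (W - 1)}) S)"
proof -
  let ?H = "g (W - 1)"
  let ?u = "{W} \<times> {b..<?H}"
  note P' = column_shape_add_column[OF P h]
  have "n = W + ?H - 1"
    using baxter_slicing_polyomino[OF b] column_shape_poly_size[OF P] by simp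
  then have size: "poly_size (fst S \<union> ?u) = Suc n"
    using column_shape_poly_size[OF P'] column_shape_pos[OF P] by auto
  have col: "right_column (fst S \<union> ?u) = ?u"
    using column_shape_right_column[OF P'] by simp
  have "fst S \<union> ?u - ?u = fst S" using column_shape_mem[OF P] by auto
  then have "baxter_slicing n (fst S \<union> ?u - right_column (fst S \<union> ?u), snd S)"
    using b col by simp
  then have "baxter_slicing (Suc n)
      (fst S \<union> ?u, insert (Vertical, right_column (fst S \<union> ?u)) (snd S))"
    using P' size by (intro baxter_slicing.vertical) (auto simp: parallelogram_polyomino_iff)
  then show ?thesis unfolding add_block_def col .
qed

section \<open>Criteria for addable rows and columns\<close>

lemma skinny_parallelogram: "skinny m S \<Longrightarrow> parallelogram_polyomino (fst S)"
  unfolding skinny_def using baxter_slicing_polyomino by blast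

text \<open>A new row ends at the right edge of the polyomino, so its r(u) is the final run
  \<open>last_run f W\<close>. A row longer than the top row would spoil the shape.\<close>

lemma skinny_add_row_iff:
  assumes S: "skinny m S" and P: "column_shape W f g (fst S)" and a: "a < W"
  shows "skinny m (add_block Horizontal ({a..<W} \<times> {g (W - 1)}) S) \<longleftrightarrow>
    g a = g (W - 1) \<and> W - a \<le> last_run f W + m" (is "skinny m ?S \<longleftrightarrow> _")
proof (cases "g a = g (W - 1)")
  case True
  let ?u = "{a..<W} \<times> {g (W - 1)}"
  note P' = column_shape_add_row[OF P a True]
  have "fst ` ?u = {a..<W}" by simp
  moreover have "Max {a..<W} = W - 1" using a by (intro Max_eqI) auto
  ultimately have M: "Max (fst ` ?u) = W - 1" by simp
  then have "r_steps (fst S \<union> ?u) ?u = last_run f W"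
    using r_steps_eq[OF P', of ?u] a by simp
  then show ?thesis
    using skinny_extend[OF S P P' _ _ baxter_slicing_add_row[OF _ P a True]] True a
    by (simp add: width_rectangle)
next
  case False
  then show ?thesis
    using add_row_parallelogramD[OF P a] skinny_parallelogram[of m ?S]
    by (auto simp: add_block_def)
qed

text \<open>Vertical blocks carry no skinny condition, so only the shape restricts them.\<close>

lemma skinny_add_column_iff:
  assumes S: "skinny m S" and P: "column_shape W f g (fst S)" and b: "b < g (W - 1)"
  shows "skinny m (add_block Vertical ({W} \<times> {b..<g (W - 1)}) S) \<longleftrightarrow> f (W - 1) \<le> b"
    (is "skinny m ?S \<longleftrightarrow> _")
proof (cases "f (W - 1) \<le> b")
  case True
  show ?thesis
    using skinny_extend[OF S P column_shape_add_column[OF P b True] _ _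
        baxter_slicing_add_column[OF _ P b True]] True
    by simp
next
  case False
  then show ?thesis
    using add_column_parallelogramD[OF P b] skinny_parallelogram[of m ?S]
    by (auto simp: add_block_def)
qed

section \<open>Labels of the children\<close>

text \<open>Rows are indexed by width and columns by height, because these become components of the
  labels of the children.\<close>

definition row_block :: "nat \<Rightarrow> nat \<Rightarrow> nat \<Rightarrow> cell set" where
  "row_block W H w = {W - w..<W} \<times> {H}"

definition column_block :: "nat \<Rightarrow> nat \<Rightarrow> nat \<Rightarrow> cell set" where
  "column_block W H j = {W} \<times> {H - j..<H}"

lemma addable_rows_eq:
  assumes S: "skinny m S" and P: "column_shape W f g (fst S)"
    and t: "t \<le> W" "\<forall>i<W. g i = g (W - 1) \<longleftrightarrow> W - t \<le> i"
  shows "addable_rows m S = row_block W (g (W - 1)) ` {1..min t (last_run f W + m)}"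
proof -
  let ?H = "g (W - 1)"
  note dim = column_shape_dimensions[OF P]
  show ?thesis
  proof (intro set_eqI iffI)
    fix u assume "u \<in> addable_rows m S"
    then obtain a where a: "a < W" and u: "u = {a..<W} \<times> {?H}"
      and sk: "skinny m (add_block Horizontal u S)"
      by (auto simp: addable_rows_def new_rows_def dim)
    then have "g a = ?H \<and> W - a \<le> last_run f W + m"
      using skinny_add_row_iff[OF S P a] by simp
    then have "W - a \<in> {1..min t (last_run f W + m)}" using a t by auto
    moreover have "u = row_block W ?H (W - a)" using u a by (simp add: row_block_def)
    ultimately show "u \<in> row_block W ?H ` {1..min t (last_run f W + m)}" by blast
  next
    fix u assume "u \<in> row_block W ?H ` {1..min t (last_run f W + m)}"
    then obtain w where w: "1 \<le> w" "w \<le> t" "w \<le> last_run f W + m" "u = row_block W ?H w"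
      by auto
    then have a: "W - w < W" "g (W - w) = ?H" "W - (W - w) = w"
      using t by auto
    then have "skinny m (add_block Horizontal u S)"
      using skinny_add_row_iff[OF S P a(1)] w by (simp add: row_block_def)
    then show "u \<in> addable_rows m S"
      using a w by (auto simp: addable_rows_def new_rows_def dim row_block_def)
  qed
qed

lemma addable_columns_eq:
  assumes S: "skinny m S" and P: "column_shape W f g (fst S)"
  shows "addable_columns m S = column_block W (g (W - 1)) ` {1..g (W - 1) - f (W - 1)}"
proof -
  let ?H = "g (W - 1)"
  note dim = column_shape_dimensions[OF P]
  show ?thesis
  proof (intro set_eqI iffI)
    fix u assume "u \<in> addable_columns m S"
    then obtain b where b: "b < ?H" and u: "u = {W} \<times> {b..<?H}"
      and sk: "skinny m (add_block Vertical u S)"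
      by (auto simp: addable_columns_def new_columns_def dim)
    then have "f (W - 1) \<le> b"
      using skinny_add_column_iff[OF S P b] by simp
    then have "?H - b \<in> {1..?H - f (W - 1)}" using b by auto
    moreover have "u = column_block W ?H (?H - b)" using u b by (simp add: column_block_def)
    ultimately show "u \<in> column_block W ?H ` {1..?H - f (W - 1)}" by blast
  next
    fix u assume "u \<in> column_block W ?H ` {1..?H - f (W - 1)}"
    then obtain j where j: "1 \<le> j" "j \<le> ?H - f (W - 1)" "u = column_block W ?H j"
      by auto
    then have b: "?H - j < ?H" "f (W - 1) \<le> ?H - j"
      by auto
    then have "skinny m (add_block Vertical u S)"
      using skinny_add_column_iff[OF S P b(1)] j by (simp add: column_block_def)
    then show "u \<in> addable_columns m S"
      using b j by (auto simp: addable_columns_def new_columns_def dim column_block_def)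
  qed
qed

text \<open>\<open>stairs f W\<close> ends with a horizontal step. This keeps the range of addable
  widths nonempty even for \<open>m = 0\<close>.\<close>

lemma last_run_pos: "column_shape W f g P \<Longrightarrow> 1 \<le> last_run f W"
  by (cases W) (auto simp: column_shape_def last_run_Suc)

text \<open>Every width from 1 up to the bound occurs among the addable rows, so the maximum is the
  bound itself.\<close>

lemma label_eq:
  assumes S: "skinny m S" and P: "column_shape W f g (fst S)"
    and t: "1 \<le> t" "t \<le> W" "\<forall>i<W. g i = g (W - 1) \<longleftrightarrow> W - t \<le> i"
  shows "label m S = (min t (last_run f W + m), g (W - 1) - f (W - 1))"
proof -
  let ?M = "min t (last_run f W + m)"
  have "width (row_block W (g (W - 1)) w) = w" if "w \<in> {1..?M}" for w
    using that t by (auto simp: row_block_def width_rectangle)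
  then have "width ` addable_rows m S = {1..?M}"
    by (simp add: addable_rows_eq[OF S P t(2,3)] image_image)
  moreover have "Max {1..?M} = ?M"
    using t last_run_pos[OF P] by (intro Max_eqI) auto
  moreover have "height (right_column (fst S)) = g (W - 1) - f (W - 1)"
    using column_shape_less[OF P, of "W - 1"] column_shape_pos[OF P]
    by (simp add: column_shape_right_column[OF P] height_rectangle)
  ultimately show ?thesis by (simp add: label_def)
qed

text \<open>The lower border stays and the new row becomes the top row, so \<open>t\<close> becomes
  \<open>w\<close>. As \<open>w\<close> already obeys the skinny bound, the minimum is
  \<open>w\<close>.\<close>

lemma label_add_row:
  assumes S: "skinny m S" and P: "column_shape W f g (fst S)"
    and t: "t \<le> W" "\<forall>i<W. g i = g (W - 1) \<longleftrightarrow> W - t \<le> i"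
    and w: "1 \<le> w" "w \<le> t" "w \<le> last_run f W + m"
  shows "label m (add_block Horizontal (row_block W (g (W - 1)) w) S) =
    (w, Suc (g (W - 1) - f (W - 1)))"
proof -
  let ?H = "g (W - 1)"
  let ?S = "add_block Horizontal (row_block W ?H w) S"
  let ?g = "\<lambda>i. if W - w \<le> i then Suc ?H else g i"
  have a: "W - w < W" "g (W - w) = ?H" using t w by auto
  have sk: "skinny m ?S"
    using skinny_add_row_iff[OF S P a(1)] a w t by (simp add: row_block_def)
  have P': "column_shape W f ?g (fst ?S)"
    using column_shape_add_row[OF P a] by (simp add: add_block_def row_block_def)
  \<comment> \<open>Old tops are at most \<open>?H\<close>, so only the columns under the new row
    reach \<open>Suc ?H\<close>.\<close>
  have "?g i = ?g (W - 1) \<longleftrightarrow> W - w \<le> i" if "i < W" for i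
    using column_shape_le_top[OF P that] a w by auto
  then have "label m ?S = (min w (last_run f W + m), ?g (W - 1) - f (W - 1))"
    using w t by (intro label_eq[OF sk P']) auto
  then show ?thesis
    using w a column_shape_less[OF P, of "W - 1"] by (auto simp: Suc_diff_le less_imp_le)
qed

text \<open>The new column joins the top row, so \<open>t\<close> grows by one. Its horizontal step
  prolongs the final run exactly when its bottom is level with that of the last column, that is,
  when it is equally high.\<close>

lemma label_add_column:
  assumes S: "skinny m S" and P: "column_shape W f g (fst S)"
    and t: "1 \<le> t" "t \<le> W" "\<forall>i<W. g i = g (W - 1) \<longleftrightarrow> W - t \<le> i"
    and j: "1 \<le> j" "j \<le> g (W - 1) - f (W - 1)"
  shows "label m (add_block Vertical (column_block W (g (W - 1)) j) S) =
    (min (Suc t) (Suc (if j = g (W - 1) - f (W - 1) then last_run f W else 0) + m), j)"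
proof -
  let ?H = "g (W - 1)"
  let ?S = "add_block Vertical (column_block W ?H j) S"
  let ?f = "f(W := ?H - j)" and ?g = "g(W := ?H)"
  have b: "?H - j < ?H" "f (W - 1) \<le> ?H - j" using j by auto
  obtain k where k: "W = Suc k" using column_shape_pos[OF P] by (cases W) auto
  have sk: "skinny m ?S"
    using skinny_add_column_iff[OF S P b(1)] b by (simp add: column_block_def)
  have P': "column_shape (Suc W) ?f ?g (fst ?S)"
    using column_shape_add_column[OF P b] by (simp add: add_block_def column_block_def)
  have "\<forall>i<Suc W. ?g i = ?g (Suc W - 1) \<longleftrightarrow> Suc W - Suc t \<le> i"
    using t by (auto simp: less_Suc_eq)
  then have l: "label m ?S = (min (Suc t) (last_run ?f (Suc W) + m), j)"
    using label_eq[OF sk P', of "Suc t"] t b j by auto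
  \<comment> \<open>The update at \<open>W\<close> does not touch the steps before it.\<close>
  have "last_run ?f W = last_run f W"
    using stairs_cong[of W ?f f] by (simp add: last_run_def)
  moreover have "staircase ?f (Suc W)" using P' by (simp add: column_shape_def)
  moreover have base_f: "base ?f W = f (W - 1)" using k by simp
  ultimately have "last_run ?f (Suc W) = Suc (if ?H - j = f (W - 1) then last_run f W else 0)"
    using last_run_Suc[of ?f W] k by (simp only: fun_upd_same base_f)
  moreover have "?H - j = f (W - 1) \<longleftrightarrow> j = ?H - f (W - 1)" using j by auto
  ultimately show ?thesis using l by simp
qed

section \<open>Counting the children with multiplicity\<close>

lemma inj_on_add_block:
  assumes "\<And>x. x \<in> A \<Longrightarrow> B x \<inter> fst S = {}" "inj_on B A"
  shows "inj_on (\<lambda>x. add_block t (B x) S) A"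
proof (rule inj_onI)
  fix x y assume x: "x \<in> A" "y \<in> A" "add_block t (B x) S = add_block t (B y) S"
  then have "fst S \<union> B x = fst S \<union> B y" by (simp add: add_block_def)
  \<comment> \<open>Disjointness from \<open>fst S\<close> lets the block be recovered from the
    union.\<close>
  then have "B x = B y" using assms(1)[OF x(1)] assms(1)[OF x(2)] by blast
  then show "x = y" using assms(2) x by (simp add: inj_on_def)
qed

text \<open>An equation of multisets requires that distinct parameters give distinct children: the
  width recovers a row, the height a column.\<close>

lemma children_labels:
  assumes S: "skinny m S" and P: "column_shape W f g (fst S)"
    and t: "1 \<le> t" "t \<le> W" "\<forall>i<W. g i = g (W - 1) \<longleftrightarrow> W - t \<le> i"
    and h: "h = min t (last_run f W + m)" and k: "k = g (W - 1) - f (W - 1)"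
  shows "{# label m S'. S' \<in># mset_set (children m S) #} =
    {# (w, Suc k). w \<in># mset_set {1..h} #} +
    {# (min (Suc t) (Suc (if j = k then last_run f W else 0) + m), j). j \<in># mset_set {1..k} #}"
proof -
  let ?H = "g (W - 1)"
  let ?R = "\<lambda>w. add_block Horizontal (row_block W ?H w) S"
  let ?C = "\<lambda>j. add_block Vertical (column_block W ?H j) S"
  have out: "i < W \<and> j < ?H" if "(i, j) \<in> fst S" for i j
    using that column_shape_fst_image[OF P] column_shape_snd_image[OF P]
    by (metis fst_conv snd_conv imageI lessThan_iff)
  have "inj_on (row_block W ?H) {1..h}"
  proof (rule inj_onI)
    fix x y assume xy: "x \<in> {1..h}" "y \<in> {1..h}" and eq: "row_block W ?H x = row_block W ?H y"
    have "width (row_block W ?H z) = z" if "z \<in> {1..h}" for z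
      using that t h by (auto simp: row_block_def width_rectangle)
    then show "x = y" using xy eq by metis
  qed
  then have injR: "inj_on ?R {1..h}"
    using out by (intro inj_on_add_block) (fastforce simp: row_block_def)+
  have "inj_on (column_block W ?H) {1..k}"
  proof (rule inj_onI)
    fix x y assume xy: "x \<in> {1..k}" "y \<in> {1..k}"
      and eq: "column_block W ?H x = column_block W ?H y"
    have "height (column_block W ?H z) = z" if "z \<in> {1..k}" for z
      using that k by (auto simp: column_block_def height_rectangle)
    then show "x = y" using xy eq by metis
  qed
  then have injC: "inj_on ?C {1..k}"
    using out by (intro inj_on_add_block) (fastforce simp: column_block_def)+
  \<comment> \<open>The cell \<open>(W - 1, ?H)\<close> tells the two kinds apart: every new row
    contains it, while a column addition stays below height \<open>?H\<close>.\<close>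
  have "?R w \<noteq> ?C j" if w: "w \<in> {1..h}" for w j
  proof
    assume "?R w = ?C j"
    then have "fst S \<union> row_block W ?H w = fst S \<union> column_block W ?H j"
      by (simp add: add_block_def)
    moreover have "(W - 1, ?H) \<in> row_block W ?H w"
      using w t by (auto simp: row_block_def)
    ultimately have "(W - 1, ?H) \<in> fst S \<union> column_block W ?H j" by blast
    then show False using out by (auto simp: column_block_def)
  qed
  then have disj: "?R ` {1..h} \<inter> ?C ` {1..k} = {}" by blast
  have "children m S = ?R ` {1..h} \<union> ?C ` {1..k}"
    unfolding children_def addable_rows_eq[OF S P t(2,3)] addable_columns_eq[OF S P] image_image
      h k ..
  then have "mset_set (children m S) = mset_set (?R ` {1..h}) + mset_set (?C ` {1..k})"
    using disj by (simp add: mset_set_Union)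
  \<comment> \<open>Injectivity turns the sums over children into sums over their
    parameters.\<close>
  then have "{# label m S'. S' \<in># mset_set (children m S) #} =
      {# label m (?R w). w \<in># mset_set {1..h} #} + {# label m (?C j). j \<in># mset_set {1..k} #}"
    by (simp only: image_mset_union multiset.map_comp comp_def
        image_mset_mset_set[OF injR, symmetric] image_mset_mset_set[OF injC, symmetric])
  moreover have "{# label m (?R w). w \<in># mset_set {1..h} #} = {# (w, Suc k). w \<in># mset_set {1..h} #}"
    using label_add_row[OF S P t(2,3)] h k by (intro image_mset_cong) auto
  moreover have "{# label m (?C j). j \<in># mset_set {1..k} #} =
      {# (min (Suc t) (Suc (if j = k then last_run f W else 0) + m), j). j \<in># mset_set {1..k} #}"
    using label_add_column[OF S P t] k by (intro image_mset_cong) auto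
  ultimately show ?thesis by simp
qed

theorem theorem10:
  fixes m :: nat
  shows "skinny m single_cell \<and> label m single_cell = (1, 1) \<and>
    (\<forall>S h k. skinny m S \<and> label m S = (h, k) \<longrightarrow>
      {# label m S'. S' \<in># mset_set (children m S) #} = Omega m h k)"
proof (intro conjI allI impI)
  \<comment> \<open>The only block has kind \<open>Initial\<close>, so no horizontal block has to be
    tested.\<close>
  show sk: "skinny m single_cell"
    using baxter_slicing.single by (auto simp: skinny_def single_cell_def)
  have P: "column_shape 1 (\<lambda>_. 0) (\<lambda>_. 1) (fst single_cell)"
    using column_shape_single_cell by (simp add: single_cell_def)
  show "label m single_cell = (1, 1)"
    using label_eq[OF sk P, of 1] last_run_pos[OF P] by auto
next
  fix S h k assume *: "skinny m S \<and> label m S = (h, k)"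
  then have S: "skinny m S" by simp
  obtain W f g where P: "column_shape W f g (fst S)"
    using skinny_column_shape[OF S] by blast
  obtain t where t: "1 \<le> t" "t \<le> W" "\<forall>i<W. g i = g (W - 1) \<longleftrightarrow> W - t \<le> i"
    using top_width[OF P] by blast
  have h: "h = min t (last_run f W + m)" and k: "k = g (W - 1) - f (W - 1)"
    using label_eq[OF S P t] * by auto
  have "1 \<le> k"
    using column_shape_less[OF P, of "W - 1"] column_shape_pos[OF P] k by auto
  \<comment> \<open>The column of full height \<open>k\<close> is split off because it alone
    prolongs the final run.\<close>
  then have split: "mset_set {1..k} = mset_set {1..<k} + {#k#}"
    by (cases k) (auto simp: atLeastLessThanSuc_atLeastAtMost atLeastAtMostSuc_conv)
  let ?L = "\<lambda>j. (min (Suc t) (Suc (if j = k then last_run f W else 0) + m), j)"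
  \<comment> \<open>Both arguments of the minimum that defines \<open>h\<close> grow by one.\<close>
  have kk: "?L k = (h + 1, k)" using h by auto
  \<comment> \<open>A lower column starts a new run, of length 1.\<close>
  have less: "?L j = (min (Suc t) (Suc m), j)" if "j \<in> {1..<k}" for j
    using that by auto
  have "image_mset ?L (mset_set {1..k}) =
      (if h < m then {# (h + 1, j). j \<in># mset_set {1..k} #}
       else {# (m + 1, j). j \<in># mset_set {1..<k} #} + {# (h + 1, k) #})"
  proof (cases "h < m")
    case True
    \<comment> \<open>Here \<open>h = t\<close> and \<open>t + 1 \<le> m\<close>, so the minimum is
      \<open>t + 1\<close> whatever the run.\<close>
    then have "?L j = (h + 1, j)" for j using h by auto
    then show ?thesis using True by simp
  next
    case False
    \<comment> \<open>Here \<open>m \<le> h \<le> t\<close>, so the skinny bound for a run of length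
      1 decides.\<close>
    then have "min (Suc t) (Suc m) = m + 1" using h by auto
    then have "image_mset ?L (mset_set {1..<k}) = {# (m + 1, j). j \<in># mset_set {1..<k} #}"
      using less by (intro image_mset_cong) auto
    then show ?thesis using False kk by (simp add: split[simplified])
  qed
  then show "{# label m S'. S' \<in># mset_set (children m S) #} = Omega m h k"
    using children_labels[OF S P t h k] by (simp add: Omega_def)
qed

end
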